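(* Consider the one-dimensional DG scheme with Euler forward time discretization described in the context. Suppose $r^n>0$ (hence $c^n>0$), and $$\alpha>\max_{1\le j\le N-1}\left\{u^+_{j+\frac12},0\right\},\qquad \tilde\alpha>\frac12 D_M,\qquad D_M=\max_{1\le j\le N-1}\left\{D^{+}_{j+\frac12},D^-_{j+\frac12}\right\},$$ $$\Delta t\le\frac{1}{6z_1p_M},\qquad \Delta t\le\min_{1\le j\le N}\frac{\min\{\Phi_{j-\frac12},\Phi_{j+\frac12}\}}{6\max\{-q(x_j^1),-q(x_j^2),0\}},$$ $$\lambda\le\min_{1\le j\le N-1}\left\{\frac{\Phi_m}{6\alpha},\frac{\Phi_{j+\frac12}}{6(\alpha-u^+_{j+\frac12})}\right\},\qquad \Phi_m=\min_{1\le j\le N-1}\Phi_{j+\frac12},$$ $$\Lambda\le\min_{1\le j\le N}\min\left\{\frac{\Phi_{j-\frac12}}{6\tilde\alpha+3D^-_{j+\frac12}},\frac{\Phi_{j+\frac12}}{6\tilde\alpha+3D^+_{j-\frac12}}\right\}.$$ Moreover assume that $0\le r^n\le\Phi$, that the flux pair $(\widehat{uc},\hat u)$ is consistent, and that $$\Delta t\le\frac{1}{6z_2p_M}.$$ Then $0\le\bar r_j^{n+1}\le\bar\Phi_j$ for all $j=1,\dots,N$.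
   Context: Mesh and spaces. $\Omega=[0,2\pi]$ is partitioned uniformly into cells $I_j=(x_{j-\frac12},x_{j+\frac12})$, $j=1,\dots,N$ ($N\ge2$), of length $\Delta x$, with $x_{\frac12}=0$, $x_{N+\frac12}=2\pi$. $V_h$ is the space of functions that are polynomials of degree $\le1$ on each $I_j$. For a piecewise smooth $v$, $v^-_{j+\frac12}$ and $v^+_{j+\frac12}$ are its left and right limits at $x_{j+\frac12}$, with $v^-_{\frac12}=0$ and $v^+_{N+\frac12}=0$ in jumps; $[v]=v^+-v^-$, $\{v\}=\frac12(v^++v^-)$. $\bar v_j$ is the average of $v$ over $I_j$. $(v,w)=\int_\Omega vw\,dx$. Data. $\phi>0$ is the porosity; $\Phi$ is its continuous piecewise linear interpolant with $\Phi_{j+\frac12}=\phi(x_{j+\frac12})$. $z_1,z_2>0$ are compressibility factors. $a(c)=\mu(c)/\kappa$ ($\mu$ viscosity, $\kappa$ permeability), $q$ is the external flow rate, $\tilde c\in[0,1]$ is the concentration in the external flow, with $\tilde c$ equal to the numerical $c$ at points where $q<0$. $D(u)\ge0$ is the diffusion coefficient and $D^\pm_{j+\frac12}=D(u^\pm_{j+\frac12})$. $\alpha,\tilde\alpha$ are positive constants. For $r\in V_h$, $c\in V_h$ is the piecewise linear function with $c^+_{j-\frac12}=r^+_{j-\frac12}/\Phi_{j-\frac12}$ and $c^-_{j+\frac12}=r^-_{j+\frac12}/\Phi_{j+\frac12}$ in each $I_j$; $\tilde d(r)=z_1r+z_2(\Phi-r)$. Scheme. $p,u,r\in V_h$ are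 such that for all $\xi,\eta,\zeta\in V_h$ $$(\tilde d(r)p_t,\xi)=(u,\xi_x)+\sum_{j=1}^{N-1}\hat u[\xi]_{j+\frac12}+(q,\xi),$$ $$(a(c)u,\eta)=(p,\eta_x)+\sum_{j=0}^{N}\hat p[\eta]_{j+\frac12},$$ $$(r_t,\zeta)=(uc-D(u)c_x,\zeta_x)+\sum_{j=1}^{N-1}\widehat{uc}[\zeta]_{j+\frac12}-\sum_{j=1}^{N-1}\{D(u)c_x\}[\zeta]_{j+\frac12}-\sum_{j=1}^{N-1}\{D(u)\zeta_x\}[c]_{j+\frac12}-\sum_{j=1}^{N-1}\frac{\tilde\alpha}{\Delta x}[c][\zeta]_{j+\frac12}+(\tilde cq-rz_1p_t,\zeta),$$ with fluxes $\hat u=u^+$, $\hat p=p^-$, $\widehat{uc}=u^+c^+-\alpha[c]$ at interior interfaces, and $\hat p_{\frac12}=p^+_{\frac12}$, $\hat p_{N+\frac12}=p^-_{N+\frac12}$. Two fluxes $\widehat{uc},\hat u$ are called consistent if $\widehat{uc}=\hat u$ when $c=1$ in $\Omega$ (the fluxes just given have this property). Euler forward: all quantities are at time level $n$ (superscript omitted), $p_t\in V_h$ satisfies the first equation, and $r^{n+1}\in V_h$ is given by the third equation with $r_t=(r^{n+1}-r^n)/\Delta t$, $\Delta t>0$. The source integrals ($q$, $\tilde cq$, $rz_1p_t$, $\tilde d(r)p_t$) over $I_j$ are evaluated by 2-point Gaussian quadrature with points $x_j^1,x_j^2$. Notation. $\lambda=\Delta t/\Delta x$, $\Lambda=\Delta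 t/\Delta x^2$, $p_M=\max_{i,j}\max\{p_t(x_j^i),0\}$ (max over $i=1,2$, $1\le j\le N$). Inequalities on $r^n$ hold on every cell including the one-sided limits at the endpoints. A fraction with zero denominator is interpreted as $+\infty$. *)

theory Defs
  imports "HOL-Analysis.Analysis" "HOL-Computational_Algebra.Polynomial"
begin

text \<open>
  Interfaces are indexed by natural numbers: index \<open>j\<close> in \<open>{0..N}\<close> stands for \<open>x\<^sub>j\<^sub>+\<^sub>1\<^sub>/\<^sub>2\<close>, so the
  cell \<open>I\<^sub>j\<close> (\<open>1 \<le> j \<le> N\<close>) lies between the interfaces \<open>j - 1\<close> and \<open>j\<close>.
\<close>

definition dx :: "nat \<Rightarrow> real" where
  "dx N = 2 * pi / real N"

definition node :: "nat \<Rightarrow> nat \<Rightarrow> real" where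
  "node N j = real j * dx N"

definition cell :: "nat \<Rightarrow> nat \<Rightarrow> real set" where
  "cell N j = {node N (j - 1)<..<node N j}"

text \<open>
  Elements of \<open>V\<^sub>h\<close> are real functions; their values at the interfaces are irrelevant, only
  one-sided limits are used there.
\<close>

definition Vh :: "nat \<Rightarrow> (real \<Rightarrow> real) set" where
  "Vh N = {v. \<forall>j\<in>{1..N}. \<exists>P :: real poly. degree P \<le> 1 \<and> (\<forall>x\<in>cell N j. v x = poly P x)}"

definition trm :: "nat \<Rightarrow> (real \<Rightarrow> real) \<Rightarrow> nat \<Rightarrow> real" where
  "trm N v j = Lim (at_left (node N j)) v"

definition trp :: "nat \<Rightarrow> (real \<Rightarrow> real) \<Rightarrow> nat \<Rightarrow> real" where
  "trp N v j = Lim (at_right (node N j)) v"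

text \<open>In jumps, the exterior traces at both ends of \<open>[0, 2\<pi>]\<close> are zero.\<close>

definition jump :: "nat \<Rightarrow> (real \<Rightarrow> real) \<Rightarrow> nat \<Rightarrow> real" where
  "jump N v j = (if j = N then 0 else trp N v j) - (if j = 0 then 0 else trm N v j)"

definition cell_avg :: "nat \<Rightarrow> (real \<Rightarrow> real) \<Rightarrow> nat \<Rightarrow> real" where
  "cell_avg N v j = integral (cell N j) v / dx N"

definition ip :: "(real \<Rightarrow> real) \<Rightarrow> (real \<Rightarrow> real) \<Rightarrow> real" where
  "ip v w = integral {0..2 * pi} (\<lambda>x. v x * w x)"

definition gauss_pt :: "nat \<Rightarrow> nat \<Rightarrow> nat \<Rightarrow> real" where
  "gauss_pt N i j =
     (node N (j - 1) + node N j) / 2 + (if i = 1 then - 1 else 1) * dx N / (2 * sqrt 3)"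

definition ip_quad :: "nat \<Rightarrow> (real \<Rightarrow> real) \<Rightarrow> (real \<Rightarrow> real) \<Rightarrow> real" where
  "ip_quad N v w =
     (\<Sum>j=1..N. dx N / 2 * (\<Sum>i\<in>{1, 2}. v (gauss_pt N i j) * w (gauss_pt N i j)))"

definition is_interpolant :: "nat \<Rightarrow> (real \<Rightarrow> real) \<Rightarrow> (real \<Rightarrow> real) \<Rightarrow> bool" where
  "is_interpolant N \<phi> \<Phi> \<longleftrightarrow>
     \<Phi> \<in> Vh N \<and> continuous_on {0..2 * pi} \<Phi> \<and> (\<forall>j\<in>{0..N}. \<Phi> (node N j) = \<phi> (node N j))"

definition is_concentration ::
    "nat \<Rightarrow> (real \<Rightarrow> real) \<Rightarrow> (real \<Rightarrow> real) \<Rightarrow> (real \<Rightarrow> real) \<Rightarrow> bool" where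
  "is_concentration N \<Phi> r c \<longleftrightarrow>
     c \<in> Vh N \<and>
     (\<forall>j\<in>{1..N}. trp N c (j - 1) = trp N r (j - 1) / \<Phi> (node N (j - 1)) \<and>
                 trm N c j = trm N r j / \<Phi> (node N j))"

definition d_tilde :: "real \<Rightarrow> real \<Rightarrow> (real \<Rightarrow> real) \<Rightarrow> (real \<Rightarrow> real) \<Rightarrow> real \<Rightarrow> real" where
  "d_tilde z1 z2 \<Phi> r x = z1 * r x + z2 * (\<Phi> x - r x)"

definition u_hat :: "nat \<Rightarrow> (real \<Rightarrow> real) \<Rightarrow> nat \<Rightarrow> real" where
  "u_hat N u j = trp N u j"

definition p_hat :: "nat \<Rightarrow> (real \<Rightarrow> real) \<Rightarrow> nat \<Rightarrow> real" where
  "p_hat N p j = (if j = 0 then trp N p j else trm N p j)"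

definition uc_hat :: "nat \<Rightarrow> real \<Rightarrow> (real \<Rightarrow> real) \<Rightarrow> (real \<Rightarrow> real) \<Rightarrow> nat \<Rightarrow> real" where
  "uc_hat N \<alpha> u c j = trp N u j * trp N c j - \<alpha> * jump N c j"

definition consistent_fluxes ::
    "nat \<Rightarrow> ((real \<Rightarrow> real) \<Rightarrow> (real \<Rightarrow> real) \<Rightarrow> nat \<Rightarrow> real) \<Rightarrow> ((real \<Rightarrow> real) \<Rightarrow> nat \<Rightarrow> real) \<Rightarrow> bool"
  where
  "consistent_fluxes N F G \<longleftrightarrow>
     (\<forall>u\<in>Vh N. \<forall>c\<in>Vh N. (\<forall>j\<in>{1..N}. \<forall>x\<in>cell N j. c x = 1) \<longrightarrow>
        (\<forall>j\<in>{1..N - 1}. F u c j = G u j))"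

text \<open>
  The average \<open>{D(u) v\<^sub>x}\<close> at an interior interface. The one-sided limits of \<open>D(u)\<close> are by
  convention \<open>D(u\<^sup>-)\<close> and \<open>D(u\<^sup>+)\<close>; no continuity of \<open>D\<close> is required.
\<close>

definition diff_mean ::
    "nat \<Rightarrow> (real \<Rightarrow> real) \<Rightarrow> (real \<Rightarrow> real) \<Rightarrow> (real \<Rightarrow> real) \<Rightarrow> nat \<Rightarrow> real" where
  "diff_mean N D u v j =
     (D (trp N u j) * trp N (deriv v) j + D (trm N u j) * trm N (deriv v) j) / 2"

text \<open>
  The three equations of the scheme. Integrals of products of \<open>V\<^sub>h\<close>-functions always exist; where
  the data \<open>\<mu>\<close>, \<open>\<kappa>\<close>, \<open>D\<close> enter, existence of the integral is part of the equation.
\<close>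

definition pressure_eq ::
    "nat \<Rightarrow> real \<Rightarrow> real \<Rightarrow> (real \<Rightarrow> real) \<Rightarrow> (real \<Rightarrow> real) \<Rightarrow>
     (real \<Rightarrow> real) \<Rightarrow> (real \<Rightarrow> real) \<Rightarrow> (real \<Rightarrow> real) \<Rightarrow> bool" where
  "pressure_eq N z1 z2 \<Phi> q u r pt \<longleftrightarrow>
     (\<forall>\<xi>\<in>Vh N.
        ip_quad N (\<lambda>x. d_tilde z1 z2 \<Phi> r x * pt x) \<xi>
        = ip u (deriv \<xi>) + (\<Sum>j=1..N - 1. u_hat N u j * jump N \<xi> j) + ip_quad N q \<xi>)"

definition velocity_eq ::
    "nat \<Rightarrow> (real \<Rightarrow> real) \<Rightarrow> (real \<Rightarrow> real) \<Rightarrow>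
     (real \<Rightarrow> real) \<Rightarrow> (real \<Rightarrow> real) \<Rightarrow> (real \<Rightarrow> real) \<Rightarrow> bool" where
  "velocity_eq N \<mu> \<kappa> p u c \<longleftrightarrow>
     (\<forall>\<eta>\<in>Vh N.
        (\<lambda>x. \<mu> (c x) / \<kappa> x * u x * \<eta> x) integrable_on {0..2 * pi} \<and>
        ip (\<lambda>x. \<mu> (c x) / \<kappa> x * u x) \<eta>
        = ip p (deriv \<eta>) + (\<Sum>j=0..N. p_hat N p j * jump N \<eta> j))"

definition transport_eq ::
    "nat \<Rightarrow> real \<Rightarrow> real \<Rightarrow> real \<Rightarrow> (real \<Rightarrow> real) \<Rightarrow> (real \<Rightarrow> real) \<Rightarrow> (real \<Rightarrow> real) \<Rightarrow>
     (real \<Rightarrow> real) \<Rightarrow> (real \<Rightarrow> real) \<Rightarrow> (real \<Rightarrow> real) \<Rightarrow> (real \<Rightarrow> real) \<Rightarrow> (real \<Rightarrow> real) \<Rightarrow> bool"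
  where
  "transport_eq N z1 \<alpha> \<alpha>' D q ct u r c pt rt \<longleftrightarrow>
     (\<forall>\<zeta>\<in>Vh N.
        (\<lambda>x. (u x * c x - D (u x) * deriv c x) * deriv \<zeta> x) integrable_on {0..2 * pi} \<and>
        ip rt \<zeta>
        = ip (\<lambda>x. u x * c x - D (u x) * deriv c x) (deriv \<zeta>)
          + (\<Sum>j=1..N - 1. uc_hat N \<alpha> u c j * jump N \<zeta> j)
          - (\<Sum>j=1..N - 1. diff_mean N D u c j * jump N \<zeta> j)
          - (\<Sum>j=1..N - 1. diff_mean N D u \<zeta> j * jump N c j)
          - (\<Sum>j=1..N - 1. \<alpha>' / dx N * jump N c j * jump N \<zeta> j)
          + ip_quad N (\<lambda>x. ct x * q x - r x * z1 * pt x) \<zeta>)"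

definition holds_on_cells ::
    "nat \<Rightarrow> (real \<Rightarrow> real \<Rightarrow> bool) \<Rightarrow> (real \<Rightarrow> real) \<Rightarrow> (real \<Rightarrow> real) \<Rightarrow> bool" where
  "holds_on_cells N R f g \<longleftrightarrow>
     (\<forall>j\<in>{1..N}. (\<forall>x\<in>cell N j. R (f x) (g x)) \<and>
        R (trp N f (j - 1)) (trp N g (j - 1)) \<and> R (trm N f j) (trm N g j))"

text \<open>Fractions in the time step bounds; a zero denominator gives no restriction.\<close>

definition frac_inf :: "real \<Rightarrow> real \<Rightarrow> ereal" where
  "frac_inf a b = (if b = 0 then \<infinity> else ereal (a / b))"

definition p_M :: "nat \<Rightarrow> (real \<Rightarrow> real) \<Rightarrow> real" where
  "p_M N pt = Max ((\<lambda>(i, j). max (pt (gauss_pt N i j)) 0) ` ({1, 2} \<times> {1..N}))"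

definition D_M :: "nat \<Rightarrow> (real \<Rightarrow> real) \<Rightarrow> (real \<Rightarrow> real) \<Rightarrow> real" where
  "D_M N D u = Max ((\<lambda>j. max (D (trp N u j)) (D (trm N u j))) ` {1..N - 1})"

definition Phi_m :: "nat \<Rightarrow> (real \<Rightarrow> real) \<Rightarrow> real" where
  "Phi_m N \<Phi> = Min ((\<lambda>j. \<Phi> (node N j)) ` {1..N - 1})"

end

theory Submission
  imports Defs
begin

text \<open>
  Testing the transport equation with the indicator of a cell turns the scheme into a balance
  for the cell average: the new average is the old one, minus \<open>dt / dx\<close> times the difference of the
  interface fluxes, plus \<open>dt / 2\<close> times the source values at the two Gauss points
  (\<open>transport_cell_balance\<close>).

  For nonnegativity, the old average of \<open>r\<close> is half the sum \<open>S\<close> of the two traces of \<open>r\<close> in the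
  cell, and also half the sum of the two Gauss point values. Written in terms of the concentration
  \<open>c\<close>, every contribution of a neighbouring cell to the new average has a nonnegative coefficient:
  upwinding with \<open>\<alpha> > u\<close> and the penalty \<open>\<alpha>' > D / 2\<close> are made for that. What can be
  negative only involves values of the cell itself, and the time step restrictions split the available
  \<open>S / 2\<close> into portions that pay for it: \<open>S / 6\<close> for convection, \<open>S / 6\<close> for diffusion, \<open>S / 12\<close> for
  compression and \<open>S / 12\<close> for outflow (\<open>convection_budget\<close>, \<open>diffusion_budget\<close>,
  \<open>outflow_budget\<close>, combined in \<open>cell_update_nonneg\<close>).

  The upper bound is the same statement for the second component of the mixture. The interface flux is
  affine in \<open>c\<close>, and consistency says that its value at \<open>c = 1\<close> is the flux of the pressure
  equation. Subtracting the transport balance from the pressure balance therefore gives for \<open>\<Phi> - r\<close> a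
  balance of the same form, with concentration \<open>1 - c\<close>, injected concentration \<open>1 - ct\<close> and
  compressibility \<open>z2\<close>. Nonnegativity of its new average is the upper bound for \<open>r\<close>.
\<close>

section \<open>Traces and integrals of piecewise linear functions\<close>

lemma dx_pos: "N \<ge> 1 \<Longrightarrow> dx N > 0"
  by (simp add: dx_def)

lemma node_Suc: "node N (Suc k) = node N k + dx N"
  by (simp add: node_def algebra_simps)

lemma node_pred: "j \<ge> 1 \<Longrightarrow> node N (j - 1) = node N j - dx N"
  by (cases j) (simp_all add: node_Suc)

lemma node_mono: "N \<ge> 1 \<Longrightarrow> k \<le> l \<Longrightarrow> node N k \<le> node N l"
  using dx_pos[of N] by (simp add: node_def mult_right_mono)

lemma node_N: "N \<ge> 1 \<Longrightarrow> node N N = 2 * pi"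
  by (simp add: node_def dx_def)

lemma node_in_domain:
  assumes "N \<ge> 1" "k \<le> N" shows "node N k \<in> {0..2 * pi}"
  using node_mono[OF assms] node_N[OF assms(1)] node_mono[OF assms(1), of 0 k]
  by (simp add: node_def)

lemma cell_subset: "N \<ge> 1 \<Longrightarrow> j \<in> {1..N} \<Longrightarrow> cell N j \<subseteq> {0..2 * pi}"
  using node_in_domain[of N "j - 1"] node_in_domain[of N j]
  by (fastforce simp: cell_def)

lemma cells_disjoint:
  assumes "N \<ge> 1" "j \<noteq> k" "j \<ge> 1" "k \<ge> 1" "x \<in> cell N j" shows "x \<notin> cell N k"
proof (cases "j < k")
  case True
  then have "j \<le> k - 1" by simp
  then show ?thesis using node_mono[OF assms(1), of j "k - 1"] assms by (auto simp: cell_def)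
next
  case False
  then have "k \<le> j - 1" using assms(2) by simp
  then show ?thesis using node_mono[OF assms(1), of k "j - 1"] assms by (auto simp: cell_def)
qed

lemma eventually_cell_right:
  assumes "N \<ge> 1" shows "\<forall>\<^sub>F x in at_right (node N k). x \<in> cell N (Suc k)"
  by (rule eventually_at_rightI[of _ "node N (Suc k)"])
    (use dx_pos[OF assms] in \<open>simp_all add: cell_def node_Suc\<close>)

lemma eventually_cell_left:
  assumes "N \<ge> 1" "j \<ge> 1" shows "\<forall>\<^sub>F x in at_left (node N j). x \<in> cell N j"
proof -
  have "node N (j - 1) < node N j" using node_pred[of j N] dx_pos[of N] assms by simp
  then show ?thesis by (auto simp: cell_def eventually_at_left intro!: exI[of _ "node N (j - 1)"])
qed

text \<open>
  A trace only sees the cell next to the interface, so it may be computed from any continuous function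
  that agrees with \<open>v\<close> there.
\<close>

lemma trp_eqI:
  assumes "N \<ge> 1" "\<And>x. x \<in> cell N (Suc k) \<Longrightarrow> v x = f x" "isCont f (node N k)"
  shows "trp N v k = f (node N k)"
proof -
  have "(f \<longlongrightarrow> f (node N k)) (at_right (node N k))"
    using assms(3) by (auto simp: isCont_def intro: filterlim_at_split[THEN iffD1, THEN conjunct2])
  then have "(v \<longlongrightarrow> f (node N k)) (at_right (node N k))"
    by (rule Lim_transform_eventually)
      (rule eventually_mono[OF eventually_cell_right[OF assms(1)]], simp add: assms(2))
  then show ?thesis unfolding trp_def by (intro tendsto_Lim) auto
qed

lemma trm_eqI:
  assumes "N \<ge> 1" "j \<ge> 1" "\<And>x. x \<in> cell N j \<Longrightarrow> v x = f x" "isCont f (node N j)"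
  shows "trm N v j = f (node N j)"
proof -
  have "(f \<longlongrightarrow> f (node N j)) (at_left (node N j))"
    using assms(4) by (auto simp: isCont_def intro: filterlim_at_split[THEN iffD1, THEN conjunct1])
  then have "(v \<longlongrightarrow> f (node N j)) (at_left (node N j))"
    by (rule Lim_transform_eventually)
      (rule eventually_mono[OF eventually_cell_left[OF assms(1,2)]], simp add: assms(3))
  then show ?thesis unfolding trm_def by (intro tendsto_Lim) auto
qed

lemma Vh_affine:
  assumes "v \<in> Vh N" "j \<in> {1..N}"
  obtains a b where "\<And>x. x \<in> cell N j \<Longrightarrow> v x = a + b * x"
proof -
  obtain P :: "real poly" where P: "degree P \<le> 1" "\<forall>x\<in>cell N j. v x = poly P x"
    using assms unfolding Vh_def by blast
  obtain a Q where aQ: "P = pCons a Q" by (cases P)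
  then have "degree Q = 0" using P(1) by (cases "Q = 0") auto
  then obtain b where "P = [:a, b:]" using aQ degree_eq_zeroE by metis
  then show ?thesis using that[of a b] P(2) by (simp add: mult.commute)
qed

lemma Vh_affineI:
  assumes "\<And>j. j \<in> {1..N} \<Longrightarrow> \<exists>a b. \<forall>x\<in>cell N j. v x = a + b * x"
  shows "v \<in> Vh N"
  unfolding Vh_def
proof (intro CollectI ballI)
  fix j assume "j \<in> {1..N}"
  then obtain a b where ab: "\<forall>x\<in>cell N j. v x = a + b * x" using assms by blast
  show "\<exists>P :: real poly. degree P \<le> 1 \<and> (\<forall>x\<in>cell N j. v x = poly P x)"
    by (rule exI[of _ "[:a, b:]"]) (use ab in \<open>simp add: mult.commute\<close>)
qed

lemma trp_affine:
  assumes "j \<in> {1..N}" "\<And>x. x \<in> cell N j \<Longrightarrow> v x = a + b * x"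
  shows "trp N v (j - 1) = a + b * node N (j - 1)"
  by (rule trp_eqI) (use assms in \<open>auto intro!: continuous_intros\<close>)

lemma trm_affine:
  assumes "j \<in> {1..N}" "\<And>x. x \<in> cell N j \<Longrightarrow> v x = a + b * x"
  shows "trm N v j = a + b * node N j"
  by (rule trm_eqI) (use assms in \<open>auto intro!: continuous_intros\<close>)

lemma Vh_slope:
  assumes "j \<in> {1..N}" "\<And>x. x \<in> cell N j \<Longrightarrow> v x = a + b * x"
  shows "(trm N v j - trp N v (j - 1)) / dx N = b"
proof -
  have "node N j = node N (j - 1) + dx N" "dx N > 0"
    using node_pred[of j N] dx_pos[of N] assms(1) by auto
  then show ?thesis
    using trp_affine[of j N v a b, OF assms] trm_affine[of j N v a b, OF assms]
    by (simp add: distrib_left)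
qed

lemma Vh_diff:
  assumes "v \<in> Vh N" "w \<in> Vh N" shows "(\<lambda>x. v x - w x) \<in> Vh N"
proof (rule Vh_affineI)
  fix j assume j: "j \<in> {1..N}"
  obtain a b where 1: "\<And>x. x \<in> cell N j \<Longrightarrow> v x = a + b * x" by (rule Vh_affine[OF assms(1) j]) blast
  obtain a' b' where 2: "\<And>x. x \<in> cell N j \<Longrightarrow> w x = a' + b' * x" by (rule Vh_affine[OF assms(2) j]) blast
  show "\<exists>a b. \<forall>x\<in>cell N j. v x - w x = a + b * x"
    by (rule exI[of _ "a - a'"], rule exI[of _ "b - b'"]) (simp add: 1 2 algebra_simps)
qed

lemma const_Vh: "(\<lambda>x. a) \<in> Vh N"
  by (rule Vh_affineI) (rule exI[of _ a], rule exI[of _ 0], simp)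

lemma trace_const:
  assumes "j \<in> {1..N}"
  shows "trp N (\<lambda>x. a) (j - 1) = a" "trm N (\<lambda>x. a) j = a"
  using trp_affine[OF assms, of "\<lambda>x. a" a 0] trm_affine[OF assms, of "\<lambda>x. a" a 0] by simp_all

lemma trace_diff:
  assumes "v \<in> Vh N" "w \<in> Vh N" "j \<in> {1..N}"
  shows "trp N (\<lambda>x. v x - w x) (j - 1) = trp N v (j - 1) - trp N w (j - 1)"
    and "trm N (\<lambda>x. v x - w x) j = trm N v j - trm N w j"
proof -
  obtain a b where 1: "\<And>x. x \<in> cell N j \<Longrightarrow> v x = a + b * x" by (rule Vh_affine[OF assms(1,3)]) blast
  obtain a' b' where 2: "\<And>x. x \<in> cell N j \<Longrightarrow> w x = a' + b' * x" by (rule Vh_affine[OF assms(2,3)]) blast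
  have 3: "v x - w x = (a - a') + (b - b') * x" if "x \<in> cell N j" for x
    using 1[OF that] 2[OF that] by (simp add: algebra_simps)
  show "trp N (\<lambda>x. v x - w x) (j - 1) = trp N v (j - 1) - trp N w (j - 1)"
    by (simp add: trp_affine[OF assms(3) 1, simplified] trp_affine[OF assms(3) 2, simplified]
        trp_affine[OF assms(3) 3, simplified] algebra_simps)
  show "trm N (\<lambda>x. v x - w x) j = trm N v j - trm N w j"
    by (simp add: trm_affine[OF assms(3) 1, simplified] trm_affine[OF assms(3) 2, simplified]
        trm_affine[OF assms(3) 3, simplified] algebra_simps)
qed

lemma trace_deriv:
  assumes "v \<in> Vh N" "j \<in> {1..N}"
  shows "trp N (deriv v) (j - 1) = (trm N v j - trp N v (j - 1)) / dx N"
    and "trm N (deriv v) j = (trm N v j - trp N v (j - 1)) / dx N"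
proof -
  obtain a b where ab: "\<And>x. x \<in> cell N j \<Longrightarrow> v x = a + b * x" by (rule Vh_affine[OF assms]) blast
  have d: "deriv v x = b" if "x \<in> cell N j" for x
  proof (rule DERIV_imp_deriv)
    have "((\<lambda>x. a + b * x) has_field_derivative b) (at x)"
      by (auto intro!: derivative_eq_intros)
    then show "(v has_field_derivative b) (at x)"
      by (rule has_field_derivative_transform_within_open[of _ _ _ "cell N j"])
        (use that ab in \<open>auto simp: cell_def\<close>)
  qed
  show "trp N (deriv v) (j - 1) = (trm N v j - trp N v (j - 1)) / dx N"
    using trp_affine[OF assms(2), of "deriv v" b 0] d Vh_slope[OF assms(2) ab] by simp
  show "trm N (deriv v) j = (trm N v j - trp N v (j - 1)) / dx N"
    using trm_affine[OF assms(2), of "deriv v" b 0] d Vh_slope[OF assms(2) ab] by simp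
qed

text \<open>
  The trapezoidal rule is exact for affine functions.
\<close>

lemma integral_cell:
  assumes "v \<in> Vh N" "j \<in> {1..N}"
  shows "(v has_integral dx N * (trp N v (j - 1) + trm N v j) / 2) (cell N j)"
proof -
  obtain a b where ab: "\<And>x. x \<in> cell N j \<Longrightarrow> v x = a + b * x" by (rule Vh_affine[OF assms]) blast
  let ?F = "\<lambda>x. a * x + b * x\<^sup>2 / 2"
  have nn: "node N j = node N (j - 1) + dx N" "dx N > 0"
    using node_pred[of j N] dx_pos[of N] assms by auto
  have "((\<lambda>x. a + b * x) has_integral (?F (node N j) - ?F (node N (j - 1))))
      {node N (j - 1)..node N j}"
    by (rule fundamental_theorem_of_calculus)
      (use nn in \<open>auto intro!: derivative_eq_intros
        simp: has_real_derivative_iff_has_vector_derivative[symmetric]\<close>)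
  moreover have "?F (node N j) - ?F (node N (j - 1)) = dx N * (trp N v (j - 1) + trm N v j) / 2"
  proof -
    have "?F R - ?F L = dx N * ((a + b * L) + (a + b * R)) / 2" if "R = L + dx N" for L R
      unfolding that by (simp add: field_simps power2_eq_square)
    from this[OF nn(1)] show ?thesis
      using trp_affine[OF assms(2) ab] trm_affine[OF assms(2) ab] by simp
  qed
  ultimately have "((\<lambda>x. a + b * x) has_integral dx N * (trp N v (j - 1) + trm N v j) / 2) (cell N j)"
    using has_integral_Icc_iff_Ioo unfolding cell_def by metis
  then show ?thesis by (rule has_integral_eq[rotated]) (use ab in auto)
qed

lemma cell_avg_traces:
  assumes "v \<in> Vh N" "j \<in> {1..N}"
  shows "cell_avg N v j = (trp N v (j - 1) + trm N v j) / 2"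
  using integral_unique[OF integral_cell[OF assms]] dx_pos[of N] assms(2)
  by (simp add: cell_avg_def)

lemma cell_avg_diff:
  assumes "v \<in> Vh N" "w \<in> Vh N" "j \<in> {1..N}"
  shows "cell_avg N (\<lambda>x. v x - w x) j = cell_avg N v j - cell_avg N w j"
  using cell_avg_traces[OF Vh_diff[OF assms(1,2)] assms(3)] cell_avg_traces[OF assms(1,3)]
    cell_avg_traces[OF assms(2,3)] trace_diff[OF assms]
  by (simp add: field_simps)

text \<open>
  The position of a Gauss point inside the reference cell \<open>[0, 1]\<close>; equivalently, the weight of the
  right trace when an affine function is evaluated there.
\<close>

definition gauss_wt :: "nat \<Rightarrow> real" where
  "gauss_wt i = 1 / 2 + (if i = 1 then - 1 else 1) / (2 * sqrt 3)"

lemma gauss_wt_bounds: "0 < gauss_wt i" "gauss_wt i < 1"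
proof -
  have "sqrt 3 > (1::real)" by simp
  then have "0 < 1 / (2 * sqrt 3)" "1 / (2 * sqrt 3) < (1 / 2 :: real)"
    by (simp_all add: divide_less_eq)
  moreover have "gauss_wt i = 1 / 2 - 1 / (2 * sqrt 3) \<or> gauss_wt i = 1 / 2 + 1 / (2 * sqrt 3)"
    by (simp add: gauss_wt_def)
  ultimately show "0 < gauss_wt i" "gauss_wt i < 1" by linarith+
qed

lemma gauss_wt_sum: "gauss_wt 1 + gauss_wt 2 = 1"
  by (simp add: gauss_wt_def)

lemma gauss_pt_eq: "j \<ge> 1 \<Longrightarrow> gauss_pt N i j = node N (j - 1) + gauss_wt i * dx N"
  using node_pred[of j N] by (simp add: gauss_pt_def gauss_wt_def algebra_simps add_divide_distrib)

lemma gauss_pt_in_cell: "j \<in> {1..N} \<Longrightarrow> gauss_pt N i j \<in> cell N j"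
  using gauss_pt_eq[of j N i] node_pred[of j N] dx_pos[of N] gauss_wt_bounds[of i]
  by (auto simp: cell_def)

lemma gauss_value:
  assumes "v \<in> Vh N" "j \<in> {1..N}"
  shows "v (gauss_pt N i j) = (1 - gauss_wt i) * trp N v (j - 1) + gauss_wt i * trm N v j"
proof -
  obtain a b where ab: "\<And>x. x \<in> cell N j \<Longrightarrow> v x = a + b * x" by (rule Vh_affine[OF assms]) blast
  have "node N j = node N (j - 1) + dx N" using node_pred[of j N] assms(2) by simp
  then show ?thesis
    using ab[OF gauss_pt_in_cell[OF assms(2)], of i] trp_affine[OF assms(2) ab] trm_affine[OF assms(2) ab]
      gauss_pt_eq[of j N i] assms(2)
    by (simp add: algebra_simps)
qed

lemma interpolant_traces:
  assumes "is_interpolant N \<phi> \<Phi>" "j \<in> {1..N}"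
  shows "trp N \<Phi> (j - 1) = \<Phi> (node N (j - 1))" "trm N \<Phi> j = \<Phi> (node N j)"
proof -
  have N: "N \<ge> 1" using assms(2) by simp
  have c: "continuous_on {0..2 * pi} \<Phi>" using assms by (simp add: is_interpolant_def)
  have nn: "node N (j - 1) < node N j" using node_pred[of j N] dx_pos[of N] assms(2) by simp
  have sub: "{node N (j - 1)..node N j} \<subseteq> {0..2 * pi}"
    using node_in_domain[OF N, of "j - 1"] node_in_domain[OF N, of j] assms(2) by auto
  have c': "continuous_on {node N (j - 1)..node N j} \<Phi>" using continuous_on_subset[OF c sub] .
  show "trp N \<Phi> (j - 1) = \<Phi> (node N (j - 1))"
    unfolding trp_def by (rule tendsto_Lim) (use continuous_on_Icc_at_rightD[OF c' nn] in auto)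
  show "trm N \<Phi> j = \<Phi> (node N j)"
    unfolding trm_def by (rule tendsto_Lim) (use continuous_on_Icc_at_leftD[OF c' nn] in auto)
qed

section \<open>Testing against the indicator of a cell\<close>

abbreviation (input) cell_ind :: "nat \<Rightarrow> nat \<Rightarrow> real \<Rightarrow> real" where
  "cell_ind N j \<equiv> indicator (cell N j)"

lemma cell_ind_on_cell:
  assumes "N \<ge> 1" "j \<ge> 1" "k \<ge> 1" "x \<in> cell N k"
  shows "cell_ind N j x = (if k = j then 1 else 0)"
  using cells_disjoint[OF assms(1), of k j x] assms by (auto simp: indicator_def)

lemma cell_ind_Vh: "N \<ge> 1 \<Longrightarrow> j \<ge> 1 \<Longrightarrow> cell_ind N j \<in> Vh N"
  by (rule Vh_affineI, rule exI, rule exI[of _ 0]) (auto simp: cell_ind_on_cell)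

lemma trp_cell_ind: "N \<ge> 1 \<Longrightarrow> j \<ge> 1 \<Longrightarrow> trp N (cell_ind N j) k = (if Suc k = j then 1 else 0)"
  using trp_eqI[of N k "cell_ind N j" "\<lambda>x. if Suc k = j then 1 else 0"]
  by (simp add: cell_ind_on_cell)

lemma trm_cell_ind:
  "N \<ge> 1 \<Longrightarrow> j \<ge> 1 \<Longrightarrow> k \<ge> 1 \<Longrightarrow> trm N (cell_ind N j) k = (if k = j then 1 else 0)"
  using trm_eqI[of N k "cell_ind N j" "\<lambda>x. if k = j then 1 else 0"]
  by (simp add: cell_ind_on_cell)

lemma deriv_cell_ind:
  assumes "x \<notin> {node N (j - 1), node N j}"
  shows "deriv (cell_ind N j) x = 0"
proof (rule DERIV_imp_deriv)
  let ?S = "if x \<in> cell N j then cell N j else - {node N (j - 1)..node N j}"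
  have S: "open ?S" "x \<in> ?S" using assms by (auto simp: cell_def)
  have "((\<lambda>y. cell_ind N j x) has_field_derivative 0) (at x)" by simp
  then show "(cell_ind N j has_field_derivative 0) (at x)"
    by (rule has_field_derivative_transform_within_open[OF _ S])
      (auto simp: cell_def indicator_def split: if_splits)
qed

lemma trace_deriv_cell_ind:
  assumes "N \<ge> 1" "j \<ge> 1"
  shows "k \<le> N - 1 \<Longrightarrow> trp N (deriv (cell_ind N j)) k = 0"
    and "k \<in> {1..N} \<Longrightarrow> trm N (deriv (cell_ind N j)) k = 0"
  using trace_deriv[OF cell_ind_Vh[OF assms], of "Suc k"] trace_deriv[OF cell_ind_Vh[OF assms], of k]
    trp_cell_ind[OF assms] trm_cell_ind[OF assms] assms(1)
  by (auto simp: Suc_le_eq)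

lemma ip_deriv_cell_ind: "ip f (deriv (cell_ind N j)) = 0"
proof -
  have "((\<lambda>x. f x * deriv (cell_ind N j) x) has_integral 0) {0..2 * pi}"
    by (rule has_integral_spike_finite[of "{node N (j - 1), node N j}" _ _ "\<lambda>x. 0"])
      (use deriv_cell_ind[of _ N j] in auto)
  then show ?thesis unfolding ip_def by (rule integral_unique)
qed

lemma ip_cell_ind:
  assumes "N \<ge> 1" "j \<in> {1..N}" shows "ip f (cell_ind N j) = integral (cell N j) f"
proof -
  have "ip f (cell_ind N j) = integral {0..2 * pi} (\<lambda>x. if x \<in> cell N j then f x else 0)"
    unfolding ip_def by (rule integral_cong) (auto simp: indicator_def)
  then show ?thesis using cell_subset[OF assms] by (simp add: integral_restrict_Int Int_absorb1 Int_absorb2)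
qed

lemma ip_quad_cell_ind:
  assumes "N \<ge> 1" "j \<in> {1..N}"
  shows "ip_quad N f (cell_ind N j) = dx N / 2 * (\<Sum>i\<in>{1, 2}. f (gauss_pt N i j))"
proof -
  have g: "cell_ind N j (gauss_pt N i k) = (if k = j then 1 else 0)" if "k \<in> {1..N}" for i k
    using cell_ind_on_cell[OF assms(1) _ _ gauss_pt_in_cell[OF that]] that assms by auto
  have "ip_quad N f (cell_ind N j)
      = (\<Sum>k=1..N. if k = j then dx N / 2 * (\<Sum>i\<in>{1, 2}. f (gauss_pt N i j)) else 0)"
    unfolding ip_quad_def by (rule sum.cong) (auto simp: g)
  then show ?thesis using assms(2) by simp
qed

definition interior_flux :: "nat \<Rightarrow> (nat \<Rightarrow> real) \<Rightarrow> nat \<Rightarrow> real" where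
  "interior_flux N F k = (if k \<in> {1..N - 1} then F k else 0)"

lemma interior_flux_boundary: "k \<notin> {1..N - 1} \<Longrightarrow> interior_flux N F k = 0"
  unfolding interior_flux_def by (rule if_not_P)

text \<open>
  The indicator of cell \<open>j\<close> jumps by \<open>1\<close> at interface \<open>j - 1\<close> and by \<open>- 1\<close> at interface \<open>j\<close>; the sums of
  the scheme only run over interior interfaces, so nothing passes the ends of the domain.
\<close>

lemma sum_jump_cell_ind:
  assumes "N \<ge> 1" "j \<in> {1..N}"
  shows "(\<Sum>k=1..N - 1. F k * jump N (cell_ind N j) k)
    = interior_flux N F (j - 1) - interior_flux N F j"
proof -
  have "(\<Sum>k=1..N - 1. F k * jump N (cell_ind N j) k)
      = (\<Sum>k=1..N - 1. (if k = j - 1 then F (j - 1) else 0) - (if k = j then F j else 0))"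
    by (rule sum.cong) (use assms in \<open>auto simp: jump_def trp_cell_ind trm_cell_ind\<close>)
  then show ?thesis by (simp add: sum_subtractf interior_flux_def)
qed

text \<open>
  Convection, diffusion and penalty all reach the balance through the jump of the test function, so
  they act as one flux.
\<close>

definition transport_flux ::
    "nat \<Rightarrow> real \<Rightarrow> real \<Rightarrow> (real \<Rightarrow> real) \<Rightarrow> (real \<Rightarrow> real) \<Rightarrow> (real \<Rightarrow> real) \<Rightarrow> nat \<Rightarrow> real" where
  "transport_flux N \<alpha> \<alpha>' D u w k =
     uc_hat N \<alpha> u w k - diff_mean N D u w k - \<alpha>' / dx N * jump N w k"

text \<open>
  For a piecewise constant test function the volume integral and the symmetrizing term with
  \<open>{D(u) \<zeta>\<^sub>x}\<close> vanish. Only the interface flux and the source remain.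
\<close>

lemma transport_cell_balance:
  assumes N: "N \<ge> 2" and j: "j \<in> {1..N}" and dt: "dt > 0"
    and r: "r \<in> Vh N" and rn: "r_new \<in> Vh N"
    and eq: "transport_eq N z1 \<alpha> \<alpha>' D q ct u r c pt (\<lambda>x. (r_new x - r x) / dt)"
  shows "cell_avg N r_new j = cell_avg N r j
    - dt / dx N * (interior_flux N (transport_flux N \<alpha> \<alpha>' D u c) j
        - interior_flux N (transport_flux N \<alpha> \<alpha>' D u c) (j - 1))
    + dt / 2 * (\<Sum>i\<in>{1, 2}. ct (gauss_pt N i j) * q (gauss_pt N i j)
        - z1 * r (gauss_pt N i j) * pt (gauss_pt N i j))"
proof -
  have N1: "N \<ge> 1" and j1: "j \<ge> 1" using N j by auto
  let ?Q = "\<Sum>i\<in>{1::nat, 2}. ct (gauss_pt N i j) * q (gauss_pt N i j)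
        - z1 * r (gauss_pt N i j) * pt (gauss_pt N i j)"
  let ?F = "interior_flux N (transport_flux N \<alpha> \<alpha>' D u c)"
  have dm: "(\<Sum>k=1..N - 1. diff_mean N D u (cell_ind N j) k * jump N c k) = 0"
    by (rule sum.neutral) (use N j in \<open>auto simp: diff_mean_def trace_deriv_cell_ind\<close>)
  have "ip (\<lambda>x. (r_new x - r x) / dt) (cell_ind N j)
      = (\<Sum>k=1..N - 1. uc_hat N \<alpha> u c k * jump N (cell_ind N j) k)
          - (\<Sum>k=1..N - 1. diff_mean N D u c k * jump N (cell_ind N j) k)
          - (\<Sum>k=1..N - 1. \<alpha>' / dx N * jump N c k * jump N (cell_ind N j) k)
          + ip_quad N (\<lambda>x. ct x * q x - r x * z1 * pt x) (cell_ind N j)"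
    using eq[unfolded transport_eq_def, rule_format, OF cell_ind_Vh[OF N1 j1]] dm
    by (simp add: ip_deriv_cell_ind)
  also have "\<dots> = ?F (j - 1) - ?F j + dx N / 2 * ?Q"
    unfolding sum_jump_cell_ind[OF N1 j, of "uc_hat N \<alpha> u c"]
      sum_jump_cell_ind[OF N1 j, of "diff_mean N D u c"]
      sum_jump_cell_ind[OF N1 j, of "\<lambda>k. \<alpha>' / dx N * jump N c k"] ip_quad_cell_ind[OF N1 j]
    by (simp add: interior_flux_def transport_flux_def mult_ac)
  finally have "integral (cell N j) (\<lambda>x. r_new x - r x) / dt = ?F (j - 1) - ?F j + dx N / 2 * ?Q"
    unfolding ip_cell_ind[OF N1 j] integral_divide .
  then have I: "integral (cell N j) (\<lambda>x. r_new x - r x) = dt * (?F (j - 1) - ?F j + dx N / 2 * ?Q)"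
    using dt by (metis nonzero_mult_div_cancel_left times_divide_eq_right less_irrefl)
  have "cell_avg N r_new j - cell_avg N r j = dt / dx N * (?F (j - 1) - ?F j + dx N / 2 * ?Q)"
    unfolding cell_avg_diff[OF rn r j, symmetric] by (simp only: cell_avg_def I) simp
  also have "\<dots> = - (dt / dx N * (?F j - ?F (j - 1))) + dt / 2 * ?Q"
    using dx_pos[OF N1] by (simp add: field_simps del: sum.insert)
  finally show ?thesis by linarith
qed

lemma pressure_cell_balance:
  assumes N: "N \<ge> 2" and j: "j \<in> {1..N}"
    and eq: "pressure_eq N z1 z2 \<Phi> q u r pt"
  shows "interior_flux N (u_hat N u) j - interior_flux N (u_hat N u) (j - 1)
    = dx N / 2 * (\<Sum>i\<in>{1, 2}. q (gauss_pt N i j)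
        - d_tilde z1 z2 \<Phi> r (gauss_pt N i j) * pt (gauss_pt N i j))"
proof -
  have N1: "N \<ge> 1" and j1: "j \<ge> 1" using N j by auto
  show ?thesis
    using eq[unfolded pressure_eq_def, rule_format, OF cell_ind_Vh[OF N1 j1],
        unfolded ip_deriv_cell_ind sum_jump_cell_ind[OF N1 j] ip_quad_cell_ind[OF N1 j]]
    by (simp add: algebra_simps)
qed

text \<open>
  The jump and the derivative of \<open>1 - c\<close> are those of \<open>c\<close> with the opposite sign, and the convective
  flux of the constant \<open>1\<close> is the flux of the pressure equation. The latter is the consistency of
  the two fluxes.
\<close>

lemma transport_flux_complement:
  assumes "N \<ge> 2" "c \<in> Vh N"
  shows "interior_flux N (transport_flux N \<alpha> \<alpha>' D u (\<lambda>x. 1 - c x)) k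
    = interior_flux N (u_hat N u) k - interior_flux N (transport_flux N \<alpha> \<alpha>' D u c) k"
proof (cases "k \<in> {1..N - 1}")
  case True
  have k: "k \<in> {1..N}" "Suc k \<in> {1..N}" "k \<noteq> N" "k \<noteq> 0" using True assms(1) by auto
  have c': "(\<lambda>x. 1 - c x) \<in> Vh N" using Vh_diff[OF const_Vh assms(2)] .
  have tr: "trp N (\<lambda>x. 1 - c x) (m - 1) = 1 - trp N c (m - 1)"
    "trm N (\<lambda>x. 1 - c x) m = 1 - trm N c m"
    "trp N (deriv (\<lambda>x. 1 - c x)) (m - 1) = - trp N (deriv c) (m - 1)"
    "trm N (deriv (\<lambda>x. 1 - c x)) m = - trm N (deriv c) m" if m: "m \<in> {1..N}" for m
  proof -
    note t = trace_diff[OF const_Vh assms(2) m, of 1] trace_const[OF m, of 1]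
    show "trp N (\<lambda>x. 1 - c x) (m - 1) = 1 - trp N c (m - 1)"
      "trm N (\<lambda>x. 1 - c x) m = 1 - trm N c m" unfolding t by (rule refl)+
    show "trp N (deriv (\<lambda>x. 1 - c x)) (m - 1) = - trp N (deriv c) (m - 1)"
      "trm N (deriv (\<lambda>x. 1 - c x)) m = - trm N (deriv c) m"
      unfolding trace_deriv[OF c' m] trace_deriv[OF assms(2) m] t
      by (simp_all add: minus_divide_left)
  qed
  have "transport_flux N \<alpha> \<alpha>' D u (\<lambda>x. 1 - c x) k = u_hat N u k - transport_flux N \<alpha> \<alpha>' D u c k"
    using tr(1,3)[OF k(2)] tr(2,4)[OF k(1)] k(3,4)
    by (simp add: transport_flux_def uc_hat_def u_hat_def jump_def diff_mean_def)
      (use dx_pos[of N] assms(1) in \<open>simp add: field_simps\<close>)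
  then show ?thesis using True by (simp add: interior_flux_def)
next
  case False
  then show ?thesis by (simp add: interior_flux_boundary del: atLeastAtMost_iff)
qed

section \<open>Nonnegativity of one explicit step\<close>

text \<open>
  The conditions on one time step, cleared of the fractions whose denominators may vanish, in the form shared by the two
  components of the mixture. The compression bound is absent because it involves the
  compressibility, in which the components differ.
\<close>

locale cfl_step =
  fixes N :: nat and \<alpha> \<alpha>' dt :: real and \<Phi> D u q :: "real \<Rightarrow> real"
  assumes N: "N \<ge> 2" and dt_pos: "dt > 0" and \<alpha>_pos: "\<alpha> > 0" and \<alpha>'_pos: "\<alpha>' > 0"
    and D_nonneg: "D s \<ge> 0"
    and \<Phi>_pos: "k \<le> N \<Longrightarrow> \<Phi> (node N k) > 0"
    and upwind: "k \<in> {1..N - 1} \<Longrightarrow> trp N u k < \<alpha>"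
    and penalty: "k \<in> {1..N - 1} \<Longrightarrow> D (trp N u k) / 2 < \<alpha>'"
      "k \<in> {1..N - 1} \<Longrightarrow> D (trm N u k) / 2 < \<alpha>'"
    and outflow_cfl: "j \<in> {1..N} \<Longrightarrow> i \<in> {1, 2} \<Longrightarrow>
      6 * dt * (- q (gauss_pt N i j)) \<le> min (\<Phi> (node N (j - 1))) (\<Phi> (node N j))"
    and convection_cfl: "k \<in> {1..N - 1} \<Longrightarrow> 6 * (dt / dx N) * \<alpha> \<le> \<Phi> (node N k)"
      "k \<in> {1..N - 1} \<Longrightarrow> 6 * (dt / dx N) * (\<alpha> - trp N u k) \<le> \<Phi> (node N k)"
    and diffusion_cfl:
      "j \<in> {1..N} \<Longrightarrow> dt / (dx N)\<^sup>2 * (6 * \<alpha>' + 3 * D (trm N u j)) \<le> \<Phi> (node N (j - 1))"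
      "j \<in> {1..N} \<Longrightarrow> dt / (dx N)\<^sup>2 * (6 * \<alpha>' + 3 * D (trp N u (j - 1))) \<le> \<Phi> (node N j)"
begin

lemma dx_gt_0: "dx N > 0"
  using dx_pos N by simp

lemma concentration_traces:
  assumes conc: "is_concentration N \<Phi> s w" and s: "holds_on_cells N (\<le>) (\<lambda>x. 0) s"
    and j: "j \<in> {1..N}"
  shows "\<Phi> (node N (j - 1)) * trp N w (j - 1) = trp N s (j - 1)"
    and "\<Phi> (node N j) * trm N w j = trm N s j"
    and "0 \<le> trp N s (j - 1)" "0 \<le> trm N s j" "0 \<le> trp N w (j - 1)" "0 \<le> trm N w j"
proof -
  have pos: "\<Phi> (node N (j - 1)) > 0" "\<Phi> (node N j) > 0" using \<Phi>_pos j by auto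
  show n: "0 \<le> trp N s (j - 1)" "0 \<le> trm N s j"
    using s j trace_const[OF j, of 0] unfolding holds_on_cells_def by (metis, metis)
  have w: "trp N w (j - 1) = trp N s (j - 1) / \<Phi> (node N (j - 1))"
    "trm N w j = trm N s j / \<Phi> (node N j)"
    using conc j by (auto simp: is_concentration_def)
  show "\<Phi> (node N (j - 1)) * trp N w (j - 1) = trp N s (j - 1)"
    "\<Phi> (node N j) * trm N w j = trm N s j" "0 \<le> trp N w (j - 1)" "0 \<le> trm N w j"
    using pos n unfolding w by simp_all
qed

text \<open>
  Upwinding makes the part of each flux that comes from the neighbouring cell favourable. What is left
  is \<open>\<alpha>\<close> times the inner trace at the right interface and \<open>\<alpha> - u\<close> times the inner trace at the left
  one, and each is paid for by a sixth of the mass at that trace.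
\<close>

lemma convection_budget:
  assumes conc: "is_concentration N \<Phi> s w" and s: "holds_on_cells N (\<le>) (\<lambda>x. 0) s"
    and j: "j \<in> {1..N}"
  shows "dt / dx N * (interior_flux N (uc_hat N \<alpha> u w) j - interior_flux N (uc_hat N \<alpha> u w) (j - 1))
    \<le> (trp N s (j - 1) + trm N s j) / 6"
proof -
  let ?l = "dt / dx N"
  have l: "?l > 0" using dt_pos dx_gt_0 by simp
  note tr = concentration_traces[OF conc s]
  \<comment> \<open>The exterior trace of \<open>w\<close> has the coefficient \<open>u - \<alpha> < 0\<close> and can be dropped.\<close>
  have right: "?l * interior_flux N (uc_hat N \<alpha> u w) j \<le> trm N s j / 6"
  proof (cases "j \<in> {1..N - 1}")
    case True
    have wp: "0 \<le> trp N w j" using tr(5)[of "Suc j"] True by auto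
    have "uc_hat N \<alpha> u w j = (trp N u j - \<alpha>) * trp N w j + \<alpha> * trm N w j"
      using True by (auto simp: uc_hat_def jump_def algebra_simps)
    also have "\<dots> \<le> \<alpha> * trm N w j"
      using upwind[OF True] wp by (simp add: mult_nonpos_nonneg)
    finally have "?l * uc_hat N \<alpha> u w j \<le> ?l * \<alpha> * trm N w j"
      using mult_left_mono[OF _ less_imp_le[OF l]] by (simp only: mult.assoc)
    also have "\<dots> \<le> \<Phi> (node N j) / 6 * trm N w j"
      using convection_cfl(1)[OF True] tr(6)[OF j] by (intro mult_right_mono) (simp_all add: mult_ac)
    finally show ?thesis using True tr(2)[OF j] by (simp add: interior_flux_def)
  next
    case False
    then show ?thesis using tr(4)[OF j] by (simp add: interior_flux_boundary del: atLeastAtMost_iff)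
  qed
  \<comment> \<open>Here it has the coefficient \<open>- \<alpha>\<close>.\<close>
  have left: "?l * (- interior_flux N (uc_hat N \<alpha> u w) (j - 1)) \<le> trp N s (j - 1) / 6"
  proof (cases "j - 1 \<in> {1..N - 1}")
    case True
    have wm: "0 \<le> trm N w (j - 1)" using tr(6)[of "j - 1"] True by auto
    have "- uc_hat N \<alpha> u w (j - 1) = (\<alpha> - trp N u (j - 1)) * trp N w (j - 1) - \<alpha> * trm N w (j - 1)"
      using True by (auto simp: uc_hat_def jump_def algebra_simps)
    also have "\<dots> \<le> (\<alpha> - trp N u (j - 1)) * trp N w (j - 1)"
      using \<alpha>_pos wm by simp
    finally have "?l * (- uc_hat N \<alpha> u w (j - 1)) \<le> ?l * (\<alpha> - trp N u (j - 1)) * trp N w (j - 1)"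
      using mult_left_mono[OF _ less_imp_le[OF l]] by (simp only: mult.assoc)
    also have "\<dots> \<le> \<Phi> (node N (j - 1)) / 6 * trp N w (j - 1)"
      using convection_cfl(2)[OF True] tr(5)[OF j] by (intro mult_right_mono) (simp_all add: mult_ac)
    finally show ?thesis using True tr(1)[OF j] by (simp add: interior_flux_def)
  next
    case False
    then show ?thesis using tr(3)[OF j] by (simp add: interior_flux_boundary del: atLeastAtMost_iff)
  qed
  show ?thesis using add_mono[OF right left] by (simp add: algebra_simps add_divide_distrib)
qed

text \<open>
  Each slope of \<open>w\<close> is a difference of two traces. At each interface the terms of the adjacent
  cell are favourable: at its trace on the interface because the penalty dominates \<open>D / 2\<close>, at its
  far trace because there \<open>D \<ge> 0\<close> alone decides the sign. Within the cell, the trace at one end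
  carries the penalty of that end and the slope term of the opposite end, which is why the
  time step bound pairs \<open>\<Phi>\<close> at one interface with \<open>D\<close> at the other.
\<close>

lemma diffusion_budget:
  assumes conc: "is_concentration N \<Phi> s w" and s: "holds_on_cells N (\<le>) (\<lambda>x. 0) s"
    and j: "j \<in> {1..N}"
  defines "G \<equiv> interior_flux N (\<lambda>k. diff_mean N D u w k + \<alpha>' / dx N * jump N w k)"
  shows "dt / dx N * (G (j - 1) - G j) \<le> (trp N s (j - 1) + trm N s j) / 6"
proof -
  let ?l = "dt / dx N" and ?L = "dt / (dx N)\<^sup>2"
  have L: "?L > 0" using dt_pos dx_gt_0 by simp
  note tr = concentration_traces[OF conc s]
  have w: "w \<in> Vh N" using conc by (simp add: is_concentration_def)
  have G: "dx N * G k = D (trp N u k) / 2 * (trm N w (Suc k) - trp N w k)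
      + D (trm N u k) / 2 * (trm N w k - trp N w (k - 1)) + \<alpha>' * (trp N w k - trm N w k)"
    if k: "k \<in> {1..N - 1}" for k
  proof -
    have k': "k \<in> {1..N}" "Suc k \<in> {1..N}" "k \<noteq> N" "k \<noteq> 0" using k N by auto
    have "trp N (deriv w) k = (trm N w (Suc k) - trp N w k) / dx N"
      "trm N (deriv w) k = (trm N w k - trp N w (k - 1)) / dx N"
      using trace_deriv(1)[OF w k'(2)] trace_deriv(2)[OF w k'(1)] by simp_all
    then have "dx N * trp N (deriv w) k = trm N w (Suc k) - trp N w k"
      "dx N * trm N (deriv w) k = trm N w k - trp N w (k - 1)" using dx_gt_0 by simp_all
    moreover have "dx N * G k = D (trp N u k) / 2 * (dx N * trp N (deriv w) k)
      + D (trm N u k) / 2 * (dx N * trm N (deriv w) k) + \<alpha>' * (trp N w k - trm N w k)"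
      using k k' dx_gt_0
      by (simp add: G_def interior_flux_def diff_mean_def jump_def field_simps)
    ultimately show ?thesis by simp
  qed
  \<comment> \<open>Three nonnegative terms are dropped: the two traces in the cell to the right, and the part of
    the inner slope at the near trace.\<close>
  have right: "- (dx N * G j) \<le> D (trm N u j) / 2 * trp N w (j - 1) + \<alpha>' * trm N w j"
  proof (cases "j \<in> {1..N - 1}")
    case True
    have Sj: "Suc j \<in> {1..N}" using True N by auto
    have "0 \<le> D (trp N u j) / 2 * trm N w (Suc j)" "0 \<le> (\<alpha>' - D (trp N u j) / 2) * trp N w j"
      "0 \<le> D (trm N u j) / 2 * trm N w j"
      using D_nonneg penalty(1)[OF True] tr(5,6)[OF Sj] tr(6)[OF j] by simp_all
    then show ?thesis unfolding G[OF True] by (simp add: algebra_simps)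
  next
    case False
    then show ?thesis using D_nonneg[of "trm N u j"] \<alpha>'_pos tr(5,6)[OF j]
      by (simp add: G_def interior_flux_boundary del: atLeastAtMost_iff)
  qed
  have left: "dx N * G (j - 1) \<le> D (trp N u (j - 1)) / 2 * trm N w j + \<alpha>' * trp N w (j - 1)"
  proof (cases "j - 1 \<in> {1..N - 1}")
    case True
    have pj: "j - 1 \<in> {1..N}" "Suc (j - 1) = j" using True N by auto
    have "0 \<le> D (trm N u (j - 1)) / 2 * trp N w (j - 1 - 1)"
      "0 \<le> (\<alpha>' - D (trm N u (j - 1)) / 2) * trm N w (j - 1)"
      "0 \<le> D (trp N u (j - 1)) / 2 * trp N w (j - 1)"
      using D_nonneg penalty(2)[OF True] tr(5,6)[OF pj(1)] tr(5)[OF j] by simp_all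
    then show ?thesis unfolding G[OF True] pj(2) by argo
  next
    case False
    then show ?thesis using D_nonneg[of "trp N u (j - 1)"] \<alpha>'_pos tr(5,6)[OF j]
      by (simp add: G_def interior_flux_boundary del: atLeastAtMost_iff)
  qed
  have "?l * (G (j - 1) - G j) = ?L * (dx N * G (j - 1) - dx N * G j)"
    using dx_gt_0 by (simp add: field_simps power2_eq_square)
  also have "\<dots> \<le> ?L * ((\<alpha>' + D (trm N u j) / 2) * trp N w (j - 1)
      + (\<alpha>' + D (trp N u (j - 1)) / 2) * trm N w j)"
    using add_mono[OF right left] L by (intro mult_left_mono) (simp_all add: algebra_simps)
  also have "\<dots> = ?L * (6 * \<alpha>' + 3 * D (trm N u j)) / 6 * trp N w (j - 1)
      + ?L * (6 * \<alpha>' + 3 * D (trp N u (j - 1))) / 6 * trm N w j"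
  proof -
    have "l * ((a + d / 2) * x + (a + e / 2) * y)
        = l * (6 * a + 3 * d) / 6 * x + l * (6 * a + 3 * e) / 6 * y" for l a d e x y :: real
      by (simp add: field_simps)
    then show ?thesis .
  qed
  also have "\<dots> \<le> \<Phi> (node N (j - 1)) / 6 * trp N w (j - 1) + \<Phi> (node N j) / 6 * trm N w j"
    using diffusion_cfl[OF j] tr(5,6)[OF j] by (intro add_mono mult_right_mono) auto
  finally show ?thesis using tr(1,2)[OF j] by (simp add: add_divide_distrib)
qed

text \<open>
  Injection only adds mass. Where fluid is extracted, it has the concentration \<open>w\<close> of the fluid in place,
  and \<open>w\<close> at a Gauss point is at most \<open>s\<close> divided by the smaller end value of \<open>\<Phi>\<close>: this holds at
  both ends of the cell, and both \<open>w\<close> and \<open>s\<close> are affine.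
\<close>

lemma outflow_budget:
  assumes conc: "is_concentration N \<Phi> s w" and s: "holds_on_cells N (\<le>) (\<lambda>x. 0) s"
    and sV: "s \<in> Vh N" and j: "j \<in> {1..N}" and i: "i \<in> {1, 2}"
    and \<sigma>: "0 \<le> \<sigma>" "q (gauss_pt N i j) < 0 \<Longrightarrow> \<sigma> = w (gauss_pt N i j)"
  shows "- (s (gauss_pt N i j) / 6) \<le> dt * (\<sigma> * q (gauss_pt N i j))"
proof (cases "q (gauss_pt N i j) < 0")
  case False
  have "0 \<le> dt * (\<sigma> * q (gauss_pt N i j))" using False dt_pos \<sigma>(1) by simp
  moreover have "0 \<le> s (gauss_pt N i j)"
    using s j gauss_pt_in_cell[OF j, of i] by (auto simp: holds_on_cells_def)
  ultimately show ?thesis by simp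
next
  case True
  let ?m = "min (\<Phi> (node N (j - 1))) (\<Phi> (node N j))"
  note tr = concentration_traces[OF conc s j]
  have w: "w \<in> Vh N" using conc by (simp add: is_concentration_def)
  have w0: "0 \<le> w (gauss_pt N i j)" using \<sigma> True by simp
  have "6 * dt * (- q (gauss_pt N i j)) * w (gauss_pt N i j) \<le> ?m * w (gauss_pt N i j)"
    using outflow_cfl[OF j i] w0 by (rule mult_right_mono)
  also have "\<dots> = (1 - gauss_wt i) * (?m * trp N w (j - 1)) + gauss_wt i * (?m * trm N w j)"
    unfolding gauss_value[OF w j] by (simp only: distrib_left mult.left_commute)
  also have "\<dots> \<le> (1 - gauss_wt i) * (\<Phi> (node N (j - 1)) * trp N w (j - 1))
      + gauss_wt i * (\<Phi> (node N j) * trm N w j)"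
    using gauss_wt_bounds[of i] tr(5,6) by (intro add_mono mult_left_mono mult_right_mono) auto
  also have "\<dots> = s (gauss_pt N i j)" unfolding tr(1,2) gauss_value[OF sV j] ..
  finally show ?thesis using \<sigma>(2)[OF True] by (simp add: algebra_simps)
qed

text \<open>
  The balance is stated for a generic component with mass \<open>s\<close>, concentration \<open>w\<close>, injected
  concentration \<open>\<sigma>\<close> and compressibility \<open>z\<close>, because both components of the mixture obey it.
  Fluxes consume a third of \<open>S\<close>, sources a third of each Gauss point value; with the factor \<open>1 / 2\<close> of
  the quadrature this exhausts \<open>S / 2\<close> exactly.
\<close>

lemma cell_update_nonneg:
  assumes conc: "is_concentration N \<Phi> s w" and s: "holds_on_cells N (\<le>) (\<lambda>x. 0) s"
    and sV: "s \<in> Vh N" and j: "j \<in> {1..N}"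
    and \<sigma>: "\<And>x. x \<in> cell N j \<Longrightarrow> 0 \<le> \<sigma> x" "\<And>x. x \<in> cell N j \<Longrightarrow> q x < 0 \<Longrightarrow> \<sigma> x = w x"
    and z: "\<And>i. i \<in> {1, 2} \<Longrightarrow> 6 * dt * z * pt (gauss_pt N i j) \<le> 1"
  shows "0 \<le> cell_avg N s j
    - dt / dx N * (interior_flux N (transport_flux N \<alpha> \<alpha>' D u w) j
        - interior_flux N (transport_flux N \<alpha> \<alpha>' D u w) (j - 1))
    + dt / 2 * (\<Sum>i\<in>{1, 2}. \<sigma> (gauss_pt N i j) * q (gauss_pt N i j)
        - z * s (gauss_pt N i j) * pt (gauss_pt N i j))"
proof -
  let ?S = "trp N s (j - 1) + trm N s j"
  let ?g = "\<lambda>i. gauss_pt N i j"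
  let ?C = "interior_flux N (uc_hat N \<alpha> u w)"
  let ?G = "interior_flux N (\<lambda>k. diff_mean N D u w k + \<alpha>' / dx N * jump N w k)"
  let ?T = "interior_flux N (transport_flux N \<alpha> \<alpha>' D u w)"
  have split: "?T k = ?C k - ?G k" for k
    by (simp add: interior_flux_def transport_flux_def)
  have flux: "dt / dx N * (?T j - ?T (j - 1)) \<le> ?S / 3"
    using add_mono[OF convection_budget[OF conc s j] diffusion_budget[OF conc s j]]
    unfolding split right_diff_distrib by linarith
  have src: "- (s (?g i) / 3) \<le> dt * (\<sigma> (?g i) * q (?g i) - z * s (?g i) * pt (?g i))"
    if i: "i \<in> {1, 2}" for i
  proof -
    have g: "?g i \<in> cell N j" using gauss_pt_in_cell[OF j] .
    have s0: "0 \<le> s (?g i)" using s j g by (auto simp: holds_on_cells_def)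
    have "- (s (?g i) / 6) \<le> dt * (\<sigma> (?g i) * q (?g i))"
      using outflow_budget[OF conc s sV j i \<sigma>(1)[OF g] \<sigma>(2)[OF g]] .
    moreover have "6 * dt * z * pt (?g i) * s (?g i) \<le> 1 * s (?g i)"
      using z[OF i] s0 by (rule mult_right_mono)
    ultimately show ?thesis by (simp add: algebra_simps)
  qed
  have "s (?g 1) + s (?g 2)
      = (2 - (gauss_wt 1 + gauss_wt 2)) * trp N s (j - 1) + (gauss_wt 1 + gauss_wt 2) * trm N s j"
    unfolding gauss_value[OF sV j] by (simp add: algebra_simps)
  then have gs: "s (?g 1) + s (?g 2) = ?S" unfolding gauss_wt_sum by simp
  have "- (?S / 6) \<le> dt / 2 * (\<Sum>i\<in>{1, 2}. \<sigma> (?g i) * q (?g i) - z * s (?g i) * pt (?g i))"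
  proof -
    have sum: "dt / 2 * (\<Sum>i\<in>{1::nat, 2}. h i) = (dt * h 1 + dt * h 2) / 2" for h
      by (simp add: algebra_simps)
    have halve: "- (S / 6) \<le> (x + y) / 2"
      if "- (a / 3) \<le> x" "- (b / 3) \<le> y" "a + b = S" for S a b x y :: real
      using that by (simp add: field_simps)
    show ?thesis unfolding sum by (rule halve[OF src src gs]) auto
  qed
  then show ?thesis using flux unfolding cell_avg_traces[OF sV j] by linarith
qed

end

section \<open>Boundedness of the updated cell averages\<close>

lemma le_frac_infD:
  assumes "ereal a \<le> frac_inf b d" "b \<ge> 0" "d \<ge> 0" shows "a * d \<le> b"
  using assms by (cases "d = 0") (auto simp: frac_inf_def pos_le_divide_eq)

lemma p_M_upper:
  assumes "i \<in> {1, 2}" "j \<in> {1..N}"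
  shows "max (pt (gauss_pt N i j)) 0 \<le> p_M N pt"
  unfolding p_M_def by (rule Max_ge) (use assms in \<open>auto intro!: rev_image_eqI[of "(i, j)"]\<close>)

lemma compression_cfl:
  assumes "ereal dt \<le> frac_inf 1 (6 * z * p_M N pt)" "dt > 0" "z > 0"
    and ij: "i \<in> {1, 2}" "j \<in> {1..N}"
  shows "6 * dt * z * pt (gauss_pt N i j) \<le> 1"
proof -
  have p: "pt (gauss_pt N i j) \<le> p_M N pt" "0 \<le> p_M N pt" using p_M_upper[OF ij, of pt] by auto
  have "6 * dt * z * pt (gauss_pt N i j) \<le> 6 * dt * z * p_M N pt"
    using p assms(2,3) by (intro mult_left_mono) auto
  also have "\<dots> \<le> 1" using le_frac_infD[OF assms(1)] p assms(3) by (simp add: mult_ac)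
  finally show ?thesis .
qed

theorem theorem3p2:
  fixes N :: nat
    and z1 z2 \<alpha> \<alpha>' dt :: real
    and \<phi> \<Phi> \<mu> \<kappa> D q ct p u r c pt r_new :: "real \<Rightarrow> real"
  assumes "N \<ge> 2" and "dt > 0"
    and "z1 > 0" and "z2 > 0" and "\<alpha> > 0" and "\<alpha>' > 0"
    and "\<forall>x\<in>{0..2 * pi}. \<phi> x > 0"
    and "is_interpolant N \<phi> \<Phi>"
    and "\<forall>s. D s \<ge> 0"
    and "\<forall>j\<in>{1..N}. \<forall>x\<in>cell N j. 0 \<le> ct x \<and> ct x \<le> 1 \<and> (q x < 0 \<longrightarrow> ct x = c x)"
    and "p \<in> Vh N" and "u \<in> Vh N" and "r \<in> Vh N" and "pt \<in> Vh N" and "r_new \<in> Vh N"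
    and "is_concentration N \<Phi> r c"
    and "pressure_eq N z1 z2 \<Phi> q u r pt"
    and "velocity_eq N \<mu> \<kappa> p u c"
    and "transport_eq N z1 \<alpha> \<alpha>' D q ct u r c pt (\<lambda>x. (r_new x - r x) / dt)"
    and "holds_on_cells N (<) (\<lambda>x. 0) r"
    and "\<alpha> > Max ((\<lambda>j. max (trp N u j) 0) ` {1..N - 1})"
    and "\<alpha>' > 1 / 2 * D_M N D u"
    and "ereal dt \<le> frac_inf 1 (6 * z1 * p_M N pt)"
    and "ereal dt \<le> Min ((\<lambda>j. frac_inf (min (\<Phi> (node N (j - 1))) (\<Phi> (node N j)))
            (6 * Max {- q (gauss_pt N 1 j), - q (gauss_pt N 2 j), 0})) ` {1..N})"
    and "ereal (dt / dx N) \<le> Min ((\<lambda>j. min (frac_inf (Phi_m N \<Phi>) (6 * \<alpha>))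
            (frac_inf (\<Phi> (node N j)) (6 * (\<alpha> - trp N u j)))) ` {1..N - 1})"
    and "ereal (dt / (dx N)\<^sup>2) \<le> Min ((\<lambda>j. min
            (frac_inf (\<Phi> (node N (j - 1))) (6 * \<alpha>' + 3 * D (trm N u j)))
            (frac_inf (\<Phi> (node N j)) (6 * \<alpha>' + 3 * D (trp N u (j - 1))))) ` {1..N})"
    and "holds_on_cells N (\<le>) (\<lambda>x. 0) r" and "holds_on_cells N (\<le>) r \<Phi>"
    and "consistent_fluxes N (uc_hat N \<alpha>) (u_hat N)"
    and "ereal dt \<le> frac_inf 1 (6 * z2 * p_M N pt)"
  shows "\<forall>j\<in>{1..N}. 0 \<le> cell_avg N r_new j \<and> cell_avg N r_new j \<le> cell_avg N \<Phi> j"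
proof
  note N = assms(1) and dt = assms(2) and interp = assms(8) and ct = assms(10)
    and conc = assms(16) and r0 = assms(27) and r\<Phi> = assms(28)
  have N1: "N \<ge> 1" using N by simp
  have \<Phi>V: "\<Phi> \<in> Vh N" using interp by (simp add: is_interpolant_def)
  have cV: "c \<in> Vh N" using conc by (simp add: is_concentration_def)
  have \<Phi>_pos: "\<Phi> (node N k) > 0" if "k \<le> N" for k
    using interp assms(7) that node_in_domain[OF N1 that] by (auto simp: is_interpolant_def)
  have pen: "D (trp N u k) / 2 < \<alpha>' \<and> D (trm N u k) / 2 < \<alpha>'" if "k \<in> {1..N - 1}" for k
  proof -
    have "max (D (trp N u k)) (D (trm N u k)) \<le> D_M N D u"
      unfolding D_M_def by (rule Max_ge) (use that in auto)
    then show ?thesis using assms(22) by auto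
  qed
  have up: "trp N u k < \<alpha>" if "k \<in> {1..N - 1}" for k
  proof -
    have "max (trp N u k) 0 \<le> Max ((\<lambda>j. max (trp N u j) 0) ` {1..N - 1})"
      by (rule Max_ge) (use that in auto)
    then show ?thesis using assms(21) by auto
  qed
  have \<Phi>m: "0 < Phi_m N \<Phi>"
    unfolding Phi_m_def by (subst Min_gr_iff) (use N \<Phi>_pos in auto)
  have \<Phi>m_le: "Phi_m N \<Phi> \<le> \<Phi> (node N k)" if "k \<in> {1..N - 1}" for k
    unfolding Phi_m_def by (rule Min_le) (use that in auto)
  interpret cfl_step N \<alpha> \<alpha>' dt \<Phi> D u q
  proof
    fix j i :: nat assume j: "j \<in> {1..N}" and i: "i \<in> {1, 2}"
    let ?m = "min (\<Phi> (node N (j - 1))) (\<Phi> (node N j))"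
    let ?M = "Max {- q (gauss_pt N 1 j), - q (gauss_pt N 2 j), 0}"
    have M: "0 \<le> ?M" "- q (gauss_pt N i j) \<le> ?M" by (rule Max_ge; use i in auto)+
    have m: "0 \<le> ?m" using \<Phi>_pos[of j] \<Phi>_pos[of "j - 1"] j by fastforce
    have "ereal dt \<le> frac_inf ?m (6 * ?M)"
      by (rule order_trans[OF assms(24) Min_le]) (use j in auto)
    then have "dt * (6 * ?M) \<le> ?m" by (rule le_frac_infD) (use m M in auto)
    moreover have "6 * dt * (- q (gauss_pt N i j)) \<le> 6 * dt * ?M"
      using M dt by (intro mult_left_mono) auto
    ultimately show "6 * dt * (- q (gauss_pt N i j)) \<le> ?m" by linarith
  next
    fix k assume k: "k \<in> {1..N - 1}"
    have "ereal (dt / dx N) \<le> min (frac_inf (Phi_m N \<Phi>) (6 * \<alpha>))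
            (frac_inf (\<Phi> (node N k)) (6 * (\<alpha> - trp N u k)))"
      by (rule order_trans[OF assms(25) Min_le]) (use k in auto)
    then have 1: "ereal (dt / dx N) \<le> frac_inf (Phi_m N \<Phi>) (6 * \<alpha>)"
      and 2: "ereal (dt / dx N) \<le> frac_inf (\<Phi> (node N k)) (6 * (\<alpha> - trp N u k))" by auto
    show "6 * (dt / dx N) * \<alpha> \<le> \<Phi> (node N k)"
      using le_frac_infD[OF 1] \<Phi>m \<Phi>m_le[OF k] assms(5) by (simp add: mult_ac)
    have "0 \<le> \<Phi> (node N k)" using \<Phi>_pos[of k] k by fastforce
    then show "6 * (dt / dx N) * (\<alpha> - trp N u k) \<le> \<Phi> (node N k)"
      using le_frac_infD[OF 2] up[OF k] by (simp add: mult_ac)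
  next
    fix j assume j: "j \<in> {1..N}"
    have "ereal (dt / (dx N)\<^sup>2) \<le> min
            (frac_inf (\<Phi> (node N (j - 1))) (6 * \<alpha>' + 3 * D (trm N u j)))
            (frac_inf (\<Phi> (node N j)) (6 * \<alpha>' + 3 * D (trp N u (j - 1))))"
      by (rule order_trans[OF assms(26) Min_le]) (use j in auto)
    then have 1: "ereal (dt / (dx N)\<^sup>2) \<le> frac_inf (\<Phi> (node N (j - 1))) (6 * \<alpha>' + 3 * D (trm N u j))"
      and 2: "ereal (dt / (dx N)\<^sup>2) \<le> frac_inf (\<Phi> (node N j)) (6 * \<alpha>' + 3 * D (trp N u (j - 1)))"
      by auto
    have D: "D s \<ge> 0" for s using assms(9) by simp
    show "dt / (dx N)\<^sup>2 * (6 * \<alpha>' + 3 * D (trm N u j)) \<le> \<Phi> (node N (j - 1))"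
      using le_frac_infD[OF 1] \<Phi>_pos[of "j - 1"] D[of "trm N u j"] assms(6) j
      by fastforce
    show "dt / (dx N)\<^sup>2 * (6 * \<alpha>' + 3 * D (trp N u (j - 1))) \<le> \<Phi> (node N j)"
      using le_frac_infD[OF 2] \<Phi>_pos[of j] D[of "trp N u (j - 1)"] assms(6) j by simp
  qed (use N dt assms(5,6,9) \<Phi>_pos up pen in auto)

  fix j assume j: "j \<in> {1..N}"
  let ?g = "\<lambda>i. gauss_pt N i j"
  let ?T = "\<lambda>w. interior_flux N (transport_flux N \<alpha> \<alpha>' D u w)"
  let ?U = "interior_flux N (u_hat N u)"
  note bal = transport_cell_balance[OF N j dt assms(13,15,19)]
  have lower: "0 \<le> cell_avg N r_new j"
    unfolding bal
    by (rule cell_update_nonneg[OF conc r0 assms(13) j])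
      (use ct j compression_cfl[OF assms(23) dt assms(3) _ j] in auto)

  \<comment> \<open>The upper bound is the lower bound for the second component, of mass \<open>\<Phi> - r\<close>.\<close>
  let ?s = "\<lambda>x. \<Phi> x - r x" and ?w = "\<lambda>x. 1 - c x"
  have conc': "is_concentration N \<Phi> ?s ?w"
    unfolding is_concentration_def
  proof (intro conjI ballI)
    show "?w \<in> Vh N" using Vh_diff[OF const_Vh cV] .
    fix k assume k: "k \<in> {1..N}"
    have p: "\<Phi> (node N (k - 1)) > 0" "\<Phi> (node N k) > 0" using \<Phi>_pos k by auto
    note t = trace_diff[OF const_Vh cV k] trace_diff[OF \<Phi>V assms(13) k] trace_const[OF k]
      interpolant_traces[OF interp k]
    have e: "trp N c (k - 1) = trp N r (k - 1) / \<Phi> (node N (k - 1))"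
      "trm N c k = trm N r k / \<Phi> (node N k)" using conc k by (auto simp: is_concentration_def)
    show "trp N ?w (k - 1) = trp N ?s (k - 1) / \<Phi> (node N (k - 1))"
      unfolding t e using p by (simp add: diff_divide_distrib)
    show "trm N ?w k = trm N ?s k / \<Phi> (node N k)"
      unfolding t e using p by (simp add: diff_divide_distrib)
  qed
  have s0: "holds_on_cells N (\<le>) (\<lambda>x. 0) ?s"
    using r\<Phi> unfolding holds_on_cells_def
    by (auto simp: trace_const[simplified] trace_diff[OF \<Phi>V assms(13), simplified])
  have "0 \<le> cell_avg N ?s j - dt / dx N * (?T ?w j - ?T ?w (j - 1))
    + dt / 2 * (\<Sum>i\<in>{1, 2}. (1 - ct (?g i)) * q (?g i) - z2 * ?s (?g i) * pt (?g i))"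
    by (rule cell_update_nonneg[OF conc' s0 Vh_diff[OF \<Phi>V assms(13)] j])
      (use ct j compression_cfl[OF assms(30) dt assms(4) _ j] in auto)
  also have "\<dots> = cell_avg N \<Phi> j - cell_avg N r_new j"
  proof -
    \<comment> \<open>The pressure equation is the sum of the balances of the two components.\<close>
    have mass: "dt / dx N * (?U j - ?U (j - 1))
        = dt / 2 * (\<Sum>i\<in>{1, 2}. q (?g i) - d_tilde z1 z2 \<Phi> r (?g i) * pt (?g i))"
      unfolding pressure_cell_balance[OF N j assms(17)] using dx_gt_0 by simp
    have src: "(\<Sum>i\<in>{1, 2}. (1 - ct (?g i)) * q (?g i) - z2 * ?s (?g i) * pt (?g i))
        = (\<Sum>i\<in>{1, 2}. q (?g i) - d_tilde z1 z2 \<Phi> r (?g i) * pt (?g i))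
          - (\<Sum>i\<in>{1, 2}. ct (?g i) * q (?g i) - z1 * r (?g i) * pt (?g i))"
      by (simp add: d_tilde_def algebra_simps)
    have fl: "?T ?w j - ?T ?w (j - 1) = (?U j - ?U (j - 1)) - (?T c j - ?T c (j - 1))"
      unfolding transport_flux_complement[OF N cV] by simp
    have "(f - g) - l * (x - y) + h * (Q - P) = f - (g - l * y + h * P)"
      if "l * x = h * Q" for f g l x y h Q P :: real
      using that by (simp add: right_diff_distrib)
    from this[OF mass] show ?thesis
      unfolding bal src fl cell_avg_diff[OF \<Phi>V assms(13) j] .
  qed
  finally show "0 \<le> cell_avg N r_new j \<and> cell_avg N r_new j \<le> cell_avg N \<Phi> j"
    using lower by simp
qed

end
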